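(* Let $a,b\in\mathbb{Q}$ with $a\neq0$, and for $n\in\mathbb{N}$ let $f_n(x)=\frac1a\left(T_n(ax+b)-b\right)$. Then: (1) $f_n(x)$ is monic for all $n\in\mathbb{N}$ if and only if $a=\frac12$. (2) $f_n(x)\in\mathbb{Z}[x]$ for all $n\in\mathbb{N}$ if and only if $a\in\frac12\mathbb{Z}$ and $b-1\in a\mathbb{Z}$.
   Context: $\mathbb{N}$ denotes the positive integers. $T_n(x)$ is the Chebyshev polynomial of the first kind: $T_0=1$, $T_1=x$, $T_n=2xT_{n-1}-T_{n-2}$ for $n\ge2$. *)

theory Defs
  imports Complex_Main "HOL-Computational_Algebra.Polynomial"
begin

fun cheb_T :: "nat \<Rightarrow> 'a::comm_ring_1 poly" where
  "cheb_T 0 = 1"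
| "cheb_T (Suc 0) = [:0, 1:]"
| "cheb_T (Suc (Suc n)) = 2 * [:0, 1:] * cheb_T (Suc n) - cheb_T n"

definition cheb_conj :: "rat \<Rightarrow> rat \<Rightarrow> nat \<Rightarrow> rat poly" where
  "cheb_conj a b n = smult (1 / a) (pcompose (cheb_T n) [:b, a:] - [:b:])"

end

theory Submission
  imports Defs
begin

text \<open>
  Writing \<open>f n\<close> for the conjugate of the \<open>n\<close>-th Chebyshev polynomial, its leading coefficient is
  \<open>(2a)^(n - 1)\<close>, which settles (1). For (2), put \<open>t = (b - 1)/a\<close>. The Chebyshev recurrence becomes
  \<open>f (n + 2) = 2(ax + b) f (n + 1) + 2b(x + t) - f n\<close> with \<open>f 0 = -t\<close> and \<open>f 1 = x\<close>, so
  integrality follows once \<open>2a\<close> and \<open>t\<close> are integers. Conversely, the coefficients of \<open>f 2\<close> and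
  \<open>f 3\<close> suffice: \<open>4b\<close> and \<open>12b\<^sup>2\<close> being integers forces \<open>s = 2b - 2\<close> to be an integer; the
  constant coefficients are \<open>(s + 3)t\<close> and \<open>(s + 2)(s + 4)t\<close>, so
  \<open>t = (s + 3)\<^sup>2 t - (s + 2)(s + 4)t\<close> is an integer as well.
\<close>

text \<open>Over a general commutative ring only a bound is available: in characteristic 2 the top
  coefficient vanishes from \<open>n = 2\<close> on.\<close>

lemma degree_cheb_T_le: "degree (cheb_T n :: 'a::comm_ring_1 poly) \<le> n"
proof (induction n rule: cheb_T.induct)
  case (3 n)
  have "degree (2 * [:0, 1:] * cheb_T (Suc n) :: 'a poly) \<le> Suc (Suc n)"
  proof -
    have eq: "2 * [:0, 1:] * cheb_T (Suc n) = (smult 2 (pCons 0 (cheb_T (Suc n))) :: 'a poly)"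
      by (simp add: numeral_poly)
    show ?thesis
      unfolding eq
      using 3(1) degree_smult_le[of "2::'a" "pCons 0 (cheb_T (Suc n))"]
        degree_pCons_le[of "0::'a" "cheb_T (Suc n)"] by linarith
  qed
  then show ?case using 3(2) by (simp del: mult_pCons_left mult_pCons_right add: degree_diff_le)
qed auto

text \<open>The factor 2 enters only from the second step of the recurrence on; truncated
  subtraction makes the formula cover \<open>n = 0\<close> too.\<close>

lemma coeff_cheb_T_self: "coeff (cheb_T n :: 'a::comm_ring_1 poly) n = 2 ^ (n - 1)"
proof (induction n rule: cheb_T.induct)
  case (3 n)
  have "coeff (cheb_T n :: 'a poly) (Suc (Suc n)) = 0"
    using degree_cheb_T_le[of n, where ?'a = 'a] by (intro coeff_eq_0) linarith
  then show ?case using 3(1) by (simp add: numeral_poly)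
qed auto

lemma degree_cheb_T: "degree (cheb_T n :: 'a::{idom,ring_char_0} poly) = n"
  by (intro antisym degree_cheb_T_le le_degree) (simp add: coeff_cheb_T_self)

lemma lead_coeff_cheb_conj:
  assumes "a \<noteq> 0" "n \<ge> 1"
  shows "lead_coeff (cheb_conj a b n) = (2 * a) ^ (n - 1)"
proof -
  let ?p = "pcompose (cheb_T n) [:b, a:]"
  have deg: "degree ?p = n"
    using assms by (simp add: degree_pcompose degree_cheb_T)
  have "lead_coeff ?p = 2 ^ (n - 1) * a ^ n"
    using assms by (subst lead_coeff_comp) (simp_all add: degree_cheb_T coeff_cheb_T_self)
  \<comment> \<open>The subtracted constant cannot reach the leading term because
    \<open>n \<ge> 1\<close>.\<close>
  moreover have "degree (?p - [:b:]) = n"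
    using deg assms by (simp add: degree_add_eq_left flip: add_uminus_conv_diff)
  ultimately show ?thesis
    using assms deg by (cases n) (simp_all add: cheb_conj_def power_mult_distrib)
qed

lemma cheb_conj_Suc_Suc:
  assumes "a \<noteq> 0"
  shows "cheb_conj a b (Suc (Suc n)) =
    [:2 * b, 2 * a:] * cheb_conj a b (Suc n) + [:2 * b * ((b - 1) / a), 2 * b:] - cheb_conj a b n"
proof -
  have T: "pcompose (cheb_T m) [:b, a:] = smult a (cheb_conj a b m) + [:b:]" for m
    using assms by (simp add: cheb_conj_def)
  have "pcompose (cheb_T (Suc (Suc n))) [:b, a:]
      = [:2 * b, 2 * a:] * pcompose (cheb_T (Suc n)) [:b, a:] - pcompose (cheb_T n) [:b, a:]"
    by (simp add: pcompose_diff pcompose_mult pcompose_pCons pcompose_smult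
        smult_add_right numeral_poly mult.commute)
  then have "smult a (cheb_conj a b (Suc (Suc n))) =
      smult a ([:2 * b, 2 * a:] * cheb_conj a b (Suc n))
      + ([:2 * b, 2 * a:] * [:b:] - [:b:] - [:b:]) - smult a (cheb_conj a b n)"
    unfolding T
    by (simp only: ring_distribs mult_smult_right eq_diff_eq diff_eq_eq add.assoc add.commute
        add.left_commute)
  \<comment> \<open>These are the constants left by replacing each composed polynomial by
    \<open>a * f + b\<close>; they combine to \<open>2b(ax + b - 1)\<close>, which is divisible by
    \<open>a\<close> up to the factor \<open>t\<close>.\<close>
  also have "[:2 * b, 2 * a:] * [:b:] - [:b:] - [:b:] = smult a [:2 * b * ((b - 1) / a), 2 * b:]"
    using assms by (simp add: field_simps)
  finally have "smult a (cheb_conj a b (Suc (Suc n))) = smult a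
     ([:2 * b, 2 * a:] * cheb_conj a b (Suc n) + [:2 * b * ((b - 1) / a), 2 * b:] - cheb_conj a b n)"
    by (simp only: smult_add_right smult_diff_right)
  then show ?thesis
    using assms by (simp only: smult_cancel)
qed

lemma cheb_conj_0: "cheb_conj a b 0 = [:- ((b - 1) / a):]"
  by (simp add: cheb_conj_def pcompose_1 one_pCons diff_divide_distrib)

lemma cheb_conj_Suc_0: "a \<noteq> 0 \<Longrightarrow> cheb_conj a b (Suc 0) = [:0, 1:]"
  by (simp add: cheb_conj_def pcompose_pCons)

text \<open>The induction starts at 0, so the integrality of \<open>t\<close> is used both for
  \<open>f 0 = -t\<close> and for the inhomogeneous term.\<close>

lemma coeff_cheb_conj_Ints:
  assumes "a \<noteq> 0" "2 * a \<in> \<int>" "2 * b \<in> \<int>" "(b - 1) / a \<in> \<int>"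
  shows "coeff (cheb_conj a b n) i \<in> \<int>"
proof (induction n arbitrary: i rule: cheb_T.induct)
  case (3 n)
  have "coeff [:2 * b * ((b - 1) / a), 2 * b:] i \<in> \<int>"
    using Ints_mult[OF assms(3,4)] assms(3) by (auto simp: coeff_pCons split: nat.split)
  moreover have "coeff ([:2 * b, 2 * a:] * cheb_conj a b (Suc n)) i \<in> \<int>"
    using 3(1) assms(2,3) by (auto simp: coeff_pCons split: nat.split intro!: Ints_add Ints_mult)
  ultimately show ?case
    using 3(2) by (simp only: cheb_conj_Suc_Suc[OF assms(1)] coeff_diff coeff_add Ints_add Ints_diff)
next
  case 1
  show ?case
    unfolding cheb_conj_0 using Ints_minus[OF assms(4)] by (auto simp: coeff_pCons split: nat.split)
next
  case 2
  show ?case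
    unfolding cheb_conj_Suc_0[OF assms(1)] by (auto simp: coeff_pCons split: nat.split)
qed

text \<open>With \<open>c = 4b\<close> and \<open>d = 12b\<^sup>2\<close>, both sides of
  \<open>3c\<^sup>2 = 4d\<close> equal \<open>48b\<^sup>2\<close>; parity makes \<open>c\<close>
  even, and \<open>2b = c/2\<close>.\<close>

lemma two_mult_in_Ints:
  fixes b :: rat
  assumes "4 * b \<in> \<int>" "12 * b\<^sup>2 \<in> \<int>"
  shows "2 * b \<in> \<int>"
proof -
  obtain c d where c: "4 * b = of_int c" and d: "12 * b\<^sup>2 = of_int d"
    using assms by (auto elim!: Ints_cases)
  have "of_int (3 * c\<^sup>2) = (of_int (4 * d) :: rat)"
    by (simp flip: c d add: power2_eq_square)
  then have "3 * c\<^sup>2 = 4 * d" by (simp only: of_int_eq_iff)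
  then have "even (3 * c\<^sup>2)" by simp
  then have "even c" by simp
  then obtain e where "c = 2 * e" by blast
  then have "2 * b = of_int e" using c by simp
  then show ?thesis by simp
qed

lemma Ints_cheb_conj_params:
  assumes "a \<noteq> 0" and int: "\<And>n i. n \<ge> 1 \<Longrightarrow> coeff (cheb_conj a b n) i \<in> \<int>"
  shows "2 * a \<in> \<int>" "(b - 1) / a \<in> \<int>"
proof -
  define t where "t = (b - 1) / a"
  define s where "s = 2 * b - 2"
  \<comment> \<open>Eliminating \<open>b\<close> reduces the check of the coefficients of
    \<open>f 3\<close> to polynomial identities in \<open>a\<close> and \<open>t\<close>.\<close>
  have b: "b = 1 + t * a" using assms by (simp add: t_def)
  have f2: "cheb_conj a b 2 = [:(2 * b + 1) * t, 4 * b, 2 * a:]"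
    using cheb_conj_Suc_Suc[OF assms(1), of b 0]
    by (simp add: cheb_conj_0 cheb_conj_Suc_0 assms numeral_2_eq_2 flip: t_def)
      (simp add: algebra_simps)
  have f3: "cheb_conj a b 3 = [:4 * b * (b + 1) * t, 12 * b\<^sup>2 - 3, 12 * a * b, 4 * a\<^sup>2:]"
    using cheb_conj_Suc_Suc[OF assms(1), of b 1] f2
    by (simp add: cheb_conj_Suc_0 assms numeral_2_eq_2 numeral_3_eq_3 flip: t_def)
      (simp add: b algebra_simps power2_eq_square)
  show "2 * a \<in> \<int>" using int[of 2 2] unfolding f2 by (simp add: numeral_2_eq_2)
  have "4 * b \<in> \<int>" using int[of 2 1] by (simp add: f2)
  moreover have "12 * b\<^sup>2 \<in> \<int>"
    using Ints_add[OF int[of 3 1], of 3] by (simp add: f3)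
  ultimately have "2 * b \<in> \<int>" by (rule two_mult_in_Ints)
  then have s: "s + 3 \<in> \<int>" by (simp add: s_def)
  have c2: "(s + 3) * t \<in> \<int>" using int[of 2 0] by (simp add: f2 s_def algebra_simps)
  have c3: "(s + 2) * (s + 4) * t \<in> \<int>" using int[of 3 0] by (simp add: f3 s_def algebra_simps)
  \<comment> \<open>The factors \<open>s + 2\<close> and \<open>s + 4\<close> lie symmetrically
    about \<open>s + 3\<close>, so their product is \<open>(s + 3)\<^sup>2 - 1\<close>.\<close>
  have "t = (s + 3) * ((s + 3) * t) - (s + 2) * (s + 4) * t"
    by (simp add: algebra_simps)
  then show "(b - 1) / a \<in> \<int>"
    unfolding t_def[symmetric] using Ints_diff[OF Ints_mult[OF s c2] c3] by metis
qed

theorem proposition2p5: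
  fixes a b :: rat
  assumes "a \<noteq> 0"
  shows "((\<forall>n\<ge>1. lead_coeff (cheb_conj a b n) = 1) \<longleftrightarrow> a = 1 / 2) \<and>
    ((\<forall>n\<ge>1. \<forall>i. coeff (cheb_conj a b n) i \<in> \<int>) \<longleftrightarrow>
      (\<exists>m::int. a = 1 / 2 * of_int m) \<and> (\<exists>k::int. b - 1 = a * of_int k))"
proof
  \<comment> \<open>The leading coefficient is 1 at \<open>n = 1\<close> for every \<open>a\<close>;
    \<open>n = 2\<close> is the first index that detects \<open>a\<close>.\<close>
  have "2 * a = 1" if "\<forall>n\<ge>1. lead_coeff (cheb_conj a b n) = 1"
    using that[rule_format, of 2] lead_coeff_cheb_conj[OF assms, of 2 b] by simp
  then show "(\<forall>n\<ge>1. lead_coeff (cheb_conj a b n) = 1) \<longleftrightarrow> a = 1 / 2"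
    using lead_coeff_cheb_conj[OF assms, of _ b] by fastforce
next
  have m: "(\<exists>m::int. a = 1 / 2 * of_int m) \<longleftrightarrow> 2 * a \<in> \<int>"
    by (auto simp: Ints_def field_simps)
  have k: "(\<exists>k::int. b - 1 = a * of_int k) \<longleftrightarrow> (b - 1) / a \<in> \<int>"
    using assms by (auto elim!: Ints_cases simp: field_simps)
  have "2 * b \<in> \<int>" if "2 * a \<in> \<int>" "(b - 1) / a \<in> \<int>"
  proof -
    have "2 * b = 2 * a * ((b - 1) / a) + 2" using assms by simp
    then show ?thesis using Ints_mult[OF that] by simp
  qed
  then show "(\<forall>n\<ge>1. \<forall>i. coeff (cheb_conj a b n) i \<in> \<int>) \<longleftrightarrow>
      (\<exists>m::int. a = 1 / 2 * of_int m) \<and> (\<exists>k::int. b - 1 = a * of_int k)"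
    unfolding m k using coeff_cheb_conj_Ints[OF assms] Ints_cheb_conj_params[OF assms] by blast
qed

end
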